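(* Let $A=\mathbb{K}\langle X \mid R\rangle$ be a graded algebra over a field $\mathbb{K}$, where $X$ is the set of generators and $R$ is the set of relations. Let $G$ be a reduced Gröbner basis (of the two-sided ideal generated by $R$, with respect to a fixed admissible ordering), and let $F$ be the set of leading terms of the elements of $G$ (the obstructions). For $n\ge -1$ let $C_n$ be the linear span of the $n$-chains (defined with respect to $X$ and $F$). Then $$H_{C_{-1}}=H_{\mathbb{K}}=1,\qquad H_{C_0}=H_X,\qquad H_{C_1}=H_F,$$ and $$H_A=\left(H_{C_{-1}}-H_{C_0}+H_{C_1}-H_{C_2}+\cdots\right)^{-1}.$$
   Context: $\mathbb{K}\langle X\rangle$ is the algebra of non-commutative polynomials in $X$ (the free associative algebra), whose monomials are the words in $X$; $\mathbb{K}\langle X\mid R\rangle$ is its quotient by the two-sided ideal generated by $R$. An algebra is graded if $A=\bigoplus_{n\ge 0}A_n$ with $A_iA_j\subseteq A_{i+j}$. The Hilbert series of a graded algebra (or graded space) $A=\bigoplus_{n\ge0}A_n$ is the formal series $H_A=\sum_{n\ge0}\dim(A_n)t^n$. Spans of words are graded by the degree of words, and $H_X$, $H_F$ denote the Hilbert series of the linear spans of the sets $X$, $F$. An admissible ordering is a total ordering of the monomials which is a well-ordering and satisfies: $m_1<m_2$ implies $m_1m_3<m_2m_3$ for any monomial $m_3$. $\mathrm{LT}(f)$ is the leading (largest) monomial of $f$, and $\mathrm{LC}(f)$ is its coefficient. A subset $G$ of a two-sided ideal $I$ is a Gröbner basis of $I$ if for every nonzero $f\in I$ one has $\mathrm{LT}(f)=m_1\mathrm{LT}(g)m_2$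 for some $g\in G$ and monomials $m_1,m_2$. A word is normal with respect to $G$ if it contains no $\mathrm{LT}(g)$, $g\in G$ (that is, no element of $F$), as a subword. A Gröbner basis $G$ is called reduced if for each $g\in G$: $\mathrm{LC}(g)=1$, and $g-\mathrm{LT}(g)$ is a linear combination of normal monomials. Chains and their tails are defined inductively. The $(-1)$-chain is the empty word and is its own tail. The $0$-chains are the elements of $X$, and are their own tails. For $n\ge1$, an $n$-chain is a word of the form $gt$ such that $g$ is an $(n-1)$-chain, $t$ is a normal word, and, if $r$ is the tail of $g$, then $\deg_F rt=1$, meaning that the word $rt$ contains exactly one element of $F$ as a subword, and this subword occurs at the end of $rt$. The tail of $gt$ is $t$.
   Formalization: The admissible ordering must respect left as well as right multiplication, a reduced Gröbner basis must also be minimal (no leading term contains another), and A is nonzero; generators are homogeneous of positive degree, finitely many in each degree. *)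

theory Defs
  imports
    "HOL-Algebra.Embedded_Algebras"
    "HOL-Algebra.QuotRing"
    "HOL-Library.Poly_Mapping"
    "HOL-Library.Sublist"
    "HOL-Computational_Algebra.Formal_Power_Series"
begin

section \<open>The free associative algebra\<close>

text \<open>
  Words are lists; concatenation makes them a monoid, and the convolution product on finitely
  supported functions from the library is then the product of non-commutative polynomials.
\<close>

instantiation list :: (type) monoid_add
begin

definition zero_list :: "'a list" where "0 = []"

definition plus_list :: "'a list \<Rightarrow> 'a list \<Rightarrow> 'a list" where "u + v = u @ v"

instance by standard (simp_all add: zero_list_def plus_list_def)

end

definition word_span :: "'x list set \<Rightarrow> ('x list \<Rightarrow>\<^sub>0 'k::zero) set" where
  "word_span S = {f. Poly_Mapping.keys f \<subseteq> S}"

definition free_algebra :: "'x set \<Rightarrow> ('x list \<Rightarrow>\<^sub>0 'k::field) ring" where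
  "free_algebra X = \<lparr>carrier = word_span (lists X), monoid.mult = (*), one = 1, zero = 0, add = (+)\<rparr>"

text \<open>The constants; a copy of the field inside every free algebra over it.\<close>

definition base_field :: "('x list \<Rightarrow>\<^sub>0 'k::field) set" where
  "base_field = range (Poly_Mapping.single [])"

definition residue_class ::
  "'x set \<Rightarrow> ('x list \<Rightarrow>\<^sub>0 'k::field) set \<Rightarrow> ('x list \<Rightarrow>\<^sub>0 'k) \<Rightarrow> ('x list \<Rightarrow>\<^sub>0 'k) set" where
  "residue_class X R f = (Idl\<^bsub>free_algebra X\<^esub> R) +>\<^bsub>free_algebra X\<^esub> f"

definition presented_algebra ::
  "'x set \<Rightarrow> ('x list \<Rightarrow>\<^sub>0 'k::field) set \<Rightarrow> (('x list \<Rightarrow>\<^sub>0 'k) set) ring" where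
  "presented_algebra X R = free_algebra X Quot (Idl\<^bsub>free_algebra X\<^esub> R)"

lemma keys_times_word_span:
  fixes f g :: "'x list \<Rightarrow>\<^sub>0 'k::field"
  assumes "f \<in> word_span (lists X)" "g \<in> word_span (lists X)"
  shows "f * g \<in> word_span (lists X)"
proof -
  have "Poly_Mapping.keys (f * g) \<subseteq> {a + b | a b. a \<in> Poly_Mapping.keys f \<and> b \<in> Poly_Mapping.keys g}"
    by (rule keys_mult)
  then show ?thesis
    using assms unfolding word_span_def plus_list_def by fastforce
qed

lemma ring_free_algebra: "ring (free_algebra X :: ('x list \<Rightarrow>\<^sub>0 'k::field) ring)"
proof (rule ringI)
  let ?A = "free_algebra X :: ('x list \<Rightarrow>\<^sub>0 'k) ring"
  show "abelian_group ?A"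
  proof (rule abelian_groupI)
    fix f g assume "f \<in> carrier ?A" "g \<in> carrier ?A"
    then show "f \<oplus>\<^bsub>?A\<^esub> g \<in> carrier ?A"
      using Poly_Mapping.keys_add[of f g] by (auto simp: free_algebra_def word_span_def)
  next
    fix f assume "f \<in> carrier ?A"
    then show "\<exists>g\<in>carrier ?A. g \<oplus>\<^bsub>?A\<^esub> f = \<zero>\<^bsub>?A\<^esub>"
      by (intro bexI[of _ "- f"]) (auto simp: free_algebra_def word_span_def)
  qed (auto simp: free_algebra_def word_span_def add_ac)
  show "Group.monoid ?A"
    by unfold_locales
      (auto simp: free_algebra_def keys_times_word_span mult.assoc,
       auto simp: word_span_def zero_list_def)
qed (auto simp: free_algebra_def algebra_simps)

section \<open>Gradings and Hilbert series\<close>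

text \<open>
  The locale \<open>subalgebra K V A\<close> only demands that V be a subspace of A over K (an additive
  subgroup closed under scalars); no closure under multiplication is involved.
\<close>

definition graded_algebra ::
  "('a, 'b) ring_scheme \<Rightarrow> 'a set \<Rightarrow> (nat \<Rightarrow> 'a set) \<Rightarrow> bool" where
  "graded_algebra A K V \<longleftrightarrow>
     (\<forall>n. subalgebra K (V n) A) \<and>
     (\<forall>a\<in>carrier A. \<exists>!c. (\<forall>n. c n \<in> V n) \<and> finite {n. c n \<noteq> \<zero>\<^bsub>A\<^esub>} \<and>
        a = finsum A c {n. c n \<noteq> \<zero>\<^bsub>A\<^esub>}) \<and>
     (\<forall>i j. \<forall>a\<in>V i. \<forall>b\<in>V j. a \<otimes>\<^bsub>A\<^esub> b \<in> V (i + j))"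

text \<open>
  Rational coefficients, so that a series with nonzero constant term has an inverse.
  The library dimension is meaningful only for finite-dimensional spaces.
\<close>

definition hilbert_series ::
  "('a, 'b) ring_scheme \<Rightarrow> 'a set \<Rightarrow> (nat \<Rightarrow> 'a set) \<Rightarrow> rat fps" where
  "hilbert_series A K V = Abs_fps (\<lambda>n. of_nat (ring.dim A K (V n)))"

text \<open>Letters carry degrees; all letters of degree 1 is the grading by length.\<close>

definition word_degree :: "('x \<Rightarrow> nat) \<Rightarrow> 'x list \<Rightarrow> nat" where
  "word_degree d w = sum_list (map d w)"

definition hilbert_series_subspace ::
  "'x set \<Rightarrow> ('x \<Rightarrow> nat) \<Rightarrow> ('x list \<Rightarrow>\<^sub>0 'k::field) set \<Rightarrow> rat fps" where
  "hilbert_series_subspace X d V =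
     hilbert_series (free_algebra X) base_field (\<lambda>n. V \<inter> word_span {w. word_degree d w = n})"

section \<open>Groebner bases\<close>

text \<open>
  Compatibility is required with multiplication on both sides; with multiplication on one side
  only, normal words need not span the quotient.
\<close>

definition admissible_order :: "'x set \<Rightarrow> 'x list rel \<Rightarrow> bool" where
  "admissible_order X r \<longleftrightarrow>
     well_order_on (lists X) r \<and>
     (\<forall>m1 m2. (m1, m2) \<in> r - Id \<longrightarrow>
        (\<forall>u\<in>lists X. \<forall>v\<in>lists X. (u @ m1 @ v, u @ m2 @ v) \<in> r - Id))"

definition LT :: "'x list rel \<Rightarrow> ('x list \<Rightarrow>\<^sub>0 'k::zero) \<Rightarrow> 'x list" where
  "LT r f = (THE m. m \<in> Poly_Mapping.keys f \<and> (\<forall>m'\<in>Poly_Mapping.keys f. (m', m) \<in> r))"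

definition LC :: "'x list rel \<Rightarrow> ('x list \<Rightarrow>\<^sub>0 'k::zero) \<Rightarrow> 'k" where
  "LC r f = Poly_Mapping.lookup f (LT r f)"

definition groebner_basis ::
  "'x list rel \<Rightarrow> ('x list \<Rightarrow>\<^sub>0 'k::zero) set \<Rightarrow> ('x list \<Rightarrow>\<^sub>0 'k) set \<Rightarrow> bool" where
  "groebner_basis r I G \<longleftrightarrow>
     G \<subseteq> I \<and> (\<forall>f\<in>I. f \<noteq> 0 \<longrightarrow> (\<exists>g\<in>G. g \<noteq> 0 \<and> sublist (LT r g) (LT r f)))"

definition normal_words :: "'x set \<Rightarrow> 'x list set \<Rightarrow> 'x list set" where
  "normal_words X F = {w \<in> lists X. \<forall>f\<in>F. \<not> sublist f w}"

text \<open>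
  The last conjunct is the usual minimality requirement. It does not follow from the others:
  for a letter x, the set consisting of x and xx satisfies those for the ideal generated by x.
\<close>

definition reduced_groebner_basis ::
  "'x set \<Rightarrow> 'x list rel \<Rightarrow> ('x list \<Rightarrow>\<^sub>0 'k::field) set \<Rightarrow> ('x list \<Rightarrow>\<^sub>0 'k) set \<Rightarrow> bool" where
  "reduced_groebner_basis X r I G \<longleftrightarrow>
     groebner_basis r I G \<and>
     (\<forall>g\<in>G. LC r g = 1 \<and>
        g - Poly_Mapping.single (LT r g) 1 \<in> word_span (normal_words X (LT r ` G)) \<and>
        LT r g \<in> normal_words X (LT r ` (G - {g})))"

section \<open>Chains\<close>

text \<open>
  Occurrences are counted with their position: for F consisting of aaa only, aaaa has two of
  them.
\<close>

definition occurrences :: "'x list set \<Rightarrow> 'x list \<Rightarrow> ('x list \<times> 'x list \<times> 'x list) set" where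
  "occurrences F w = {(u, f, v). f \<in> F \<and> w = u @ f @ v}"

definition single_final_occurrence :: "'x list set \<Rightarrow> 'x list \<Rightarrow> bool" where
  "single_final_occurrence F w \<longleftrightarrow> (\<exists>u f. occurrences F w = {(u, f, [])})"

text \<open>\<open>chain X F n w t\<close>: the word w is an n-chain with tail t.\<close>

inductive chain :: "'x set \<Rightarrow> 'x list set \<Rightarrow> int \<Rightarrow> 'x list \<Rightarrow> 'x list \<Rightarrow> bool"
  for X :: "'x set" and F :: "'x list set" where
  empty: "chain X F (- 1) [] []"
| letter: "x \<in> X \<Longrightarrow> chain X F 0 [x] [x]"
| step: "\<lbrakk>n \<ge> 1; chain X F (n - 1) g r; t \<in> normal_words X F; single_final_occurrence F (r @ t)\<rbrakk>
    \<Longrightarrow> chain X F n (g @ t) t"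

definition chain_space :: "'x set \<Rightarrow> 'x list set \<Rightarrow> int \<Rightarrow> ('x list \<Rightarrow>\<^sub>0 'k::field) set" where
  "chain_space X F n = word_span {w. \<exists>t. chain X F n w t}"

end

theory Submission
  imports Defs
begin

text \<open>
  Since the relations form a Groebner basis, the normal words of degree n are a basis of the n-th
  component of A, so its Hilbert series is the series of the set N of normal words. The pairs of an
  n-chain with tail t and a normal word s split according to whether ts is normal. If it is not,
  moving the shortest prefix of s that completes an obstruction over to the chain gives an
  (n+1)-chain followed by a normal word, and this matches the obstructed pairs for n with the
  unobstructed ones for n + 1. So the alternating sum of the series of n-chains, multiplied by the
  series of N, telescopes to the contribution 1 of the empty word.
\<close>

unbundle fps_syntax

section \<open>Weight series\<close>

text \<open>A letter may itself be an obstruction, so the tail of a 0-chain need not be normal;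
  hence pairs are split by normality of \<open>t @ s\<close>, and 0-chains are treated apart in the
  facts on tails. No proper prefix of a tail contains an obstruction, so the shortest obstructed
  prefix of \<open>t @ s\<close> covers \<open>t\<close> and cuts only into \<open>s\<close>. The
  cut is reversible because, of two such shortest prefixes of one word, neither can properly extend
  the other. The telescope starts at the (-1)-chain: it contributes the whole series of N, and a
  nonempty normal word is an unobstructed pair for n = 0, its first letter being the chain. The
  infinite sum makes sense because an n-chain has at least n letters of positive degree, so the
  error term moves to ever higher degrees. On the algebra side the components \<open>V n\<close> are
  abstract and only the letters are placed in them. Placing words requires 1 in \<open>V 0\<close>,
  which has to be derived; uniqueness of homogeneous decompositions then pins down each
  \<open>V n\<close>.\<close>

definition weight_series :: "('a \<Rightarrow> nat) \<Rightarrow> 'a set \<Rightarrow> rat fps" where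
  "weight_series wt S = Abs_fps (\<lambda>n. of_nat (card {a \<in> S. wt a = n}))"

lemma weight_series_nth: "weight_series wt S $ n = of_nat (card {a \<in> S. wt a = n})"
  by (simp add: weight_series_def)

lemma weight_series_bij_betw:
  assumes f: "bij_betw f S T" and wt: "\<And>a. a \<in> S \<Longrightarrow> wt' (f a) = wt a"
  shows "weight_series wt S = weight_series wt' T"
proof (rule fps_ext)
  fix n
  have "bij_betw f {a \<in> S. wt a = n} {b \<in> T. wt' b = n}"
    using f wt unfolding bij_betw_def by (auto intro: inj_on_subset)
  then show "weight_series wt S $ n = weight_series wt' T $ n"
    by (simp add: weight_series_nth bij_betw_same_card)
qed

lemma weight_series_Un:
  assumes "S \<inter> T = {}" and "\<And>n. finite {a \<in> S. wt a = n}" and "\<And>n. finite {a \<in> T. wt a = n}"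
  shows "weight_series wt (S \<union> T) = weight_series wt S + weight_series wt T"
proof (rule fps_ext)
  fix n
  have "{a \<in> S \<union> T. wt a = n} = {a \<in> S. wt a = n} \<union> {a \<in> T. wt a = n}"
    by auto
  then have "card {a \<in> S \<union> T. wt a = n} = card {a \<in> S. wt a = n} + card {a \<in> T. wt a = n}"
    using assms by (auto intro!: card_Un_disjoint)
  then show "weight_series wt (S \<union> T) $ n = (weight_series wt S + weight_series wt T) $ n"
    by (simp add: weight_series_nth)
qed

lemma weight_series_Times:
  assumes "\<And>n. finite {a \<in> S. wt a = n}" and "\<And>n. finite {b \<in> T. wt' b = n}"
  shows "weight_series (\<lambda>(a, b). wt a + wt' b) (S \<times> T) = weight_series wt S * weight_series wt' T"
proof (rule fps_ext)
  fix n
  have "{p \<in> S \<times> T. (case p of (a, b) \<Rightarrow> wt a + wt' b) = n} =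
      (\<Union>i\<in>{0..n}. {a \<in> S. wt a = i} \<times> {b \<in> T. wt' b = n - i})"
    by auto
  moreover have "card \<dots> = (\<Sum>i=0..n. card ({a \<in> S. wt a = i} \<times> {b \<in> T. wt' b = n - i}))"
    using assms by (intro card_UN_disjoint) auto
  ultimately show "weight_series (\<lambda>(a, b). wt a + wt' b) (S \<times> T) $ n =
      (weight_series wt S * weight_series wt' T) $ n"
    by (simp add: weight_series_nth fps_mult_nth card_cartesian_product)
qed

text \<open>Convergence of power series is coefficientwise, and each coefficient of the partial sums
  is eventually constant. The offset \<open>Suc m\<close> fits the later index shift: term
  \<open>k\<close> counts \<open>(k - 1)\<close>-chains, whose degrees are at least
  \<open>k - 1\<close>.\<close>

lemma fps_sums_locally_finite:
  fixes f :: "nat \<Rightarrow> 'a::ab_group_add fps"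
  assumes "\<And>k m. k > Suc m \<Longrightarrow> f k $ m = 0"
  shows "f sums Abs_fps (\<lambda>m. \<Sum>k<m+2. f k $ m)"
  unfolding sums_def
proof (rule tendsto_fpsI)
  fix m
  have "(\<Sum>k<K. f k) $ m = (\<Sum>k<m+2. f k $ m)" if "K \<ge> m + 2" for K
    unfolding fps_sum_nth by (rule sum.mono_neutral_right) (use that assms in auto)
  then show "\<forall>\<^sub>F K in sequentially. (\<Sum>k<K. f k) $ m = Abs_fps (\<lambda>m. \<Sum>k<m+2. f k $ m) $ m"
    by (auto simp: eventually_at_top_linorder)
qed

section \<open>Words and chains\<close>

lemma word_degree_append [simp]: "word_degree d (u @ v) = word_degree d u + word_degree d v"
  by (simp add: word_degree_def)

lemma word_degree_Nil [simp]: "word_degree d [] = 0"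
  by (simp add: word_degree_def)

lemma word_degree_Cons [simp]: "word_degree d (x # w) = d x + word_degree d w"
  by (simp add: word_degree_def)

lemma weight_series_Nil: "weight_series (word_degree d) {[]} = 1"
proof (rule fps_ext)
  fix n
  have "{w \<in> {[] :: 'a list}. word_degree d w = n} = (if n = 0 then {[]} else {})" by auto
  then show "weight_series (word_degree d) {[] :: 'a list} $ n = 1 $ n"
    by (simp add: weight_series_nth)
qed

lemma length_le_word_degree:
  assumes "\<And>x. x \<in> X \<Longrightarrow> d x > 0" and "w \<in> lists X"
  shows "length w \<le> word_degree d w"
  using assms(2)
proof (induction w)
  case (Cons x w)
  then show ?case using assms(1)[of x] by auto
qed auto

lemma finite_words_degree_le:
  assumes pos: "\<And>x. x \<in> X \<Longrightarrow> d x > 0" and fin: "\<And>n. finite {x \<in> X. d x = n}"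
  shows "finite {w \<in> lists X. word_degree d w \<le> m}"
proof (rule finite_subset)
  let ?Y = "{x \<in> X. d x \<le> m}"
  have "?Y = (\<Union>n\<in>{..m}. {x \<in> X. d x = n})" by auto
  then have "finite ?Y" using fin by simp
  then show "finite {w. set w \<subseteq> ?Y \<and> length w \<le> m}"
    by (rule finite_lists_length_le)
  have "d x \<le> word_degree d w" if "x \<in> set w" for x and w :: "'a list"
    using that by (auto simp: word_degree_def intro!: member_le_sum_list)
  then show "{w \<in> lists X. word_degree d w \<le> m} \<subseteq> {w. set w \<subseteq> ?Y \<and> length w \<le> m}"
    using length_le_word_degree[OF pos] by (fastforce dest: le_trans)
qed

lemma normal_words_sublist:
  "w \<in> normal_words X F \<Longrightarrow> sublist v w \<Longrightarrow> v \<in> normal_words X F"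
  unfolding normal_words_def
  by (auto dest: set_mono_sublist sublist_order.order_trans)

section \<open>Obstructions and the unique factorisation of chains\<close>

locale obstructions =
  fixes X :: "'x set" and F :: "'x list set"
  assumes obstruction_words: "F \<subseteq> lists X"
    and Nil_not_obstruction: "[] \<notin> F"
    and antichain: "\<lbrakk>f \<in> F; f' \<in> F; sublist f f'\<rbrakk> \<Longrightarrow> f = f'"
begin

text \<open>Turns the count of positioned occurrences into minimality among prefixes, the form used
  from here on. Two obstructions ending at the end of \<open>w\<close> are comparable suffixes, so
  the antichain condition makes them equal.\<close>

lemma single_final_occurrence_iff:
  "single_final_occurrence F w \<longleftrightarrow>
    (\<exists>f\<in>F. suffix f w) \<and> (\<forall>f\<in>F. \<forall>v. strict_prefix v w \<longrightarrow> \<not> sublist f v)"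
proof
  assume "single_final_occurrence F w"
  then obtain u f where uf: "occurrences F w = {(u, f, [])}"
    unfolding single_final_occurrence_def by blast
  then have "(u, f, []) \<in> occurrences F w" by simp
  then have "f \<in> F" "w = u @ f"
    by (auto simp: occurrences_def)
  moreover have "\<not> sublist f' v" if f': "f' \<in> F" and v: "strict_prefix v w" for f' v
  proof
    assume "sublist f' v"
    then obtain a b where "v = a @ f' @ b" by (auto simp: sublist_def)
    moreover obtain c where "w = v @ c" "c \<noteq> []"
      using v by (auto simp: strict_prefix_def prefix_def)
    ultimately have "(a, f', b @ c) \<in> occurrences F w"
      using f' by (simp add: occurrences_def)
    with uf \<open>c \<noteq> []\<close> show False by simp
  qed
  ultimately show "(\<exists>f\<in>F. suffix f w) \<and> (\<forall>f\<in>F. \<forall>v. strict_prefix v w \<longrightarrow> \<not> sublist f v)"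
    by (auto simp: suffix_def)
next
  assume *: "(\<exists>f\<in>F. suffix f w) \<and> (\<forall>f\<in>F. \<forall>v. strict_prefix v w \<longrightarrow> \<not> sublist f v)"
  then obtain f u where f: "f \<in> F" "w = u @ f" by (auto simp: suffix_def)
  have "u' = u \<and> f' = f \<and> v = []" if f': "f' \<in> F" "w = u' @ f' @ v" for u' f' v
  proof -
    have v: "v = []"
    proof (rule ccontr)
      assume "v \<noteq> []"
      with f' have "strict_prefix (u' @ f') w" by (auto simp: strict_prefix_def)
      with * f' show False by blast
    qed
    with f f' have "suffix f w" "suffix f' w" by (metis append_Nil2 suffixI)+
    then have "suffix f f' \<or> suffix f' f" by (rule suffix_same_cases)
    then have "f = f'" using antichain f(1) f'(1) by blast
    with v f f' show ?thesis by simp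
  qed
  then have "occurrences F w = {(u, f, [])}"
    using f by (auto simp: occurrences_def)
  then show "single_final_occurrence F w"
    unfolding single_final_occurrence_def by blast
qed

lemma single_final_occurrence_unique:
  assumes "single_final_occurrence F p" "single_final_occurrence F q" "prefix p w" "prefix q w"
  shows "p = q"
proof -
  have *: "\<not> strict_prefix p q" if "single_final_occurrence F p" "single_final_occurrence F q" for p q
    using that unfolding single_final_occurrence_iff by blast
  have "prefix p q \<or> prefix q p"
    using assms(3,4) prefix_same_cases by blast
  with *[OF assms(1,2)] *[OF assms(2,1)] show ?thesis
    by (auto simp: strict_prefix_def)
qed

text \<open>Appending letters on the right, the first moment at which an obstruction appears yields
  the prefix: the new obstruction must use the last letter.\<close>

lemma single_final_occurrence_prefix_exists:
  assumes "f \<in> F" "sublist f w"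
  shows "\<exists>p. prefix p w \<and> single_final_occurrence F p"
  using assms
proof (induction w arbitrary: f rule: rev_induct)
  case Nil
  then show ?case using Nil_not_obstruction by auto
next
  case (snoc x w)
  show ?case
  proof (cases "\<exists>f\<in>F. sublist f w")
    case True
    then show ?thesis using snoc.IH by (meson prefix_prefix)
  next
    case False
    have "suffix f (w @ [x])"
      using snoc.prems False by (auto simp: sublist_snoc)
    moreover have "\<not> sublist f' v" if "f' \<in> F" "strict_prefix v (w @ [x])" for f' v
      using that False by (metis prefix_snoc strict_prefix_def prefix_imp_sublist sublist_order.order_trans)
    ultimately show ?thesis
      using snoc.prems single_final_occurrence_iff by blast
  qed
qed

text \<open>The shortest obstructed prefix of \<open>r @ s\<close> is comparable with
  \<open>r\<close>, and the hypothesis on \<open>r\<close> forbids it to be shorter. The word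
  \<open>t\<close> may be empty, namely when \<open>r\<close> itself ends in an obstruction.\<close>

lemma single_final_occurrence_extension:
  assumes r: "\<And>f v. f \<in> F \<Longrightarrow> strict_prefix v r \<Longrightarrow> \<not> sublist f v"
    and f: "f \<in> F" "sublist f (r @ s)"
  obtains t s' where "s = t @ s'" "single_final_occurrence F (r @ t)"
proof -
  obtain p where p: "prefix p (r @ s)" "single_final_occurrence F p"
    using single_final_occurrence_prefix_exists[OF f] by blast
  have "\<not> strict_prefix p r"
    using p(2) r unfolding single_final_occurrence_iff by blast
  moreover have "prefix p r \<or> prefix r p"
    using p(1) prefix_same_cases by (metis prefixI)
  ultimately obtain t where "p = r @ t"
    by (auto simp: strict_prefix_def prefix_def)
  with p that show ?thesis by (auto simp: prefix_def)
qed

text \<open>The bound on \<open>n\<close> by the length is what later makes the alternating series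
  converge. Normality of the tail is claimed only for \<open>n \<noteq> 0\<close>, since a letter
  can be an obstruction.\<close>

lemma chain_props:
  assumes "chain X F n w t"
  shows "w \<in> lists X \<and> suffix t w \<and> n \<ge> -1 \<and> n \<le> int (length w) \<and> (n \<ge> 0 \<longrightarrow> w \<noteq> []) \<and>
    (n \<noteq> 0 \<longrightarrow> t \<in> normal_words X F) \<and> (n = 0 \<longrightarrow> length t = 1)"
  using assms
proof induction
  case empty
  then show ?case using Nil_not_obstruction by (auto simp: normal_words_def)
next
  case (letter x)
  then show ?case by auto
next
  case (step n g r t)
  \<comment> \<open>From \<open>n = 2\<close> on the previous tail is normal, so a new obstruction
    requires a new letter. For \<open>n = 1\<close> the tail can be empty, but the initial letter
    already gives length 1.\<close>
  have "t \<noteq> []" if "n \<ge> 2"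
  proof
    assume "t = []"
    with step.hyps obtain f where "f \<in> F" "suffix f r"
      unfolding single_final_occurrence_iff by auto
    moreover have "r \<in> normal_words X F" using step.IH that by auto
    ultimately show False by (auto simp: normal_words_def)
  qed
  moreover have "n = 1 \<or> n \<ge> 2" using step.hyps by auto
  moreover have "length g > 0" using step by auto
  moreover have "t \<in> lists X" using step.hyps by (auto simp: normal_words_def)
  ultimately show ?case using step
    by (auto simp: suffix_def Suc_le_eq simp flip: length_greater_0_conv)
qed

text \<open>The weakening of normality that also holds for 0-chains: their tail has one letter,
  whose only proper prefix is empty. It is the hypothesis on \<open>r\<close> in
  \<open>single_final_occurrence_extension\<close>.\<close>

lemma chain_tail_strict_prefix:
  assumes "chain X F n w t" "f \<in> F" "strict_prefix v t"
  shows "\<not> sublist f v"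
proof (cases "n = 0")
  case True
  then have "length t = 1" using chain_props[OF assms(1)] by auto
  with assms(3) have "v = []" by (auto dest: prefix_length_less)
  with assms(2) show ?thesis using Nil_not_obstruction by auto
next
  case False
  then have "t \<in> normal_words X F" using chain_props[OF assms(1)] by auto
  moreover have "sublist v t" using assms(3) by (auto simp: strict_prefix_def)
  ultimately show ?thesis using assms(2) normal_words_sublist[of t X F v]
    by (auto simp: normal_words_def)
qed

text \<open>Comparing two prefixes of a common word, instead of two decompositions of one word, is
  what lets the induction through: the shorter chains inside \<open>g\<close> and \<open>g'\<close>
  are again prefixes of \<open>w\<close>, but not yet known to have equal length. Once they agree,
  minimality of the obstructed prefix fixes the new tail.\<close>

lemma chain_unique:
  assumes "chain X F n g r" "chain X F n g' r'" "prefix g w" "prefix g' w"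
  shows "g = g' \<and> r = r'"
  using assms
proof (induction arbitrary: g' r' rule: chain.induct)
  case empty
  then show ?case by (auto elim: chain.cases)
next
  case (letter x)
  from letter(2) show ?case
    by cases (use letter in \<open>auto simp: prefix_def\<close>)
next
  case (step n g r t)
  from step.prems(1) obtain g1 r1 where g1: "g' = g1 @ r'" "chain X F (n - 1) g1 r1"
    "single_final_occurrence F (r1 @ r')"
    by cases (use step.hyps in auto)
  have eq: "g = g1 \<and> r = r1"
    using step.IH[OF g1(2)] step.prems g1(1) by (meson append_prefixD)
  obtain z where z: "w = g @ z" "prefix t z" "prefix r' z"
    using step.prems g1(1) eq by (auto simp: prefix_def)
  have "r @ t = r @ r'"
    by (rule single_final_occurrence_unique[where w = "r @ z"]) (use step.hyps g1 eq z in auto)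
  with eq g1 show ?case by simp
qed

lemma chain_tail_unique: "chain X F n w t \<Longrightarrow> chain X F n w t' \<Longrightarrow> t = t'"
  using chain_unique[of n w t w t' w] by auto

lemma chain_one_iff: "(\<exists>t. chain X F 1 w t) \<longleftrightarrow> w \<in> F"
proof
  assume "\<exists>t. chain X F 1 w t"
  then obtain t where "chain X F 1 w t" ..
  then show "w \<in> F"
  proof cases
    case (step g r)
    from step(3) obtain x where x: "g = [x]" "r = [x]" by cases auto
    with step obtain f where f: "f \<in> F" "suffix f (x # t)"
      unfolding single_final_occurrence_iff by auto
    moreover have "\<not> suffix f t"
      using step(4) f(1) by (auto simp: normal_words_def)
    ultimately have "f = x # t" by (auto simp: suffix_Cons)
    with f x step show ?thesis by simp
  qed simp_all
next
  assume w: "w \<in> F"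
  with Nil_not_obstruction obtain x t where xt: "w = x # t" by (cases w) auto
  have "w \<in> lists X" using w obstruction_words by auto
  \<comment> \<open>By the antichain condition a proper subword of an obstruction is free of
    obstructions. This gives both normality of \<open>t\<close> and the absence of an earlier
    occurrence in \<open>x # t\<close>.\<close>
  have *: "\<not> sublist f v" if "f \<in> F" "sublist v w" "length v < length w" for f v
  proof
    assume "sublist f v"
    then have "sublist f w" using that(2) by (rule sublist_order.order_trans)
    then have "f = w" using antichain that(1) w by blast
    with \<open>sublist f v\<close> that(3) show False by (auto dest: sublist_length_le)
  qed
  have "chain X F 1 ([x] @ t) t"
  proof (rule chain.step)
    show "chain X F (1 - 1) [x] [x]"
      using \<open>w \<in> lists X\<close> xt by (auto intro: chain.letter)
    show "t \<in> normal_words X F"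
      using \<open>w \<in> lists X\<close> xt *[of _ t] by (auto simp: normal_words_def sublist_Cons_right)
    have "\<not> sublist f v" if "f \<in> F" "strict_prefix v w" for f v
      using that *[of f v] by (auto simp: prefix_length_less strict_prefix_def)
    then show "single_final_occurrence F ([x] @ t)"
      unfolding single_final_occurrence_iff using w xt by auto
  qed simp
  with xt show "\<exists>t. chain X F 1 w t" by auto
qed

end

section \<open>Counting chains by degree and the telescoping sum\<close>

locale graded_obstructions = obstructions X F for X :: "'x set" and F +
  fixes d :: "'x \<Rightarrow> nat"
  assumes degree_pos: "\<And>x. x \<in> X \<Longrightarrow> d x > 0"
    and degree_finite: "\<And>n. finite {x \<in> X. d x = n}"
begin

abbreviation "chain_pairs (n :: int) \<equiv> {(w, t). chain X F n w t}"
abbreviation "normals \<equiv> normal_words X F"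
abbreviation "wdeg \<equiv> word_degree d"
abbreviation "chain_deg \<equiv> \<lambda>(w :: 'x list, t :: 'x list). wdeg w"
abbreviation "pair_deg \<equiv> \<lambda>(c, s). chain_deg c + wdeg s"

text \<open>With \<open>obstructed_pairs\<close> this splits the product of
  \<open>chain_pairs n\<close> and \<open>normals\<close>; normality of \<open>s\<close> is
  inherited here from \<open>t @ s\<close>. Below, U_n stands for the series of this set.\<close>

definition unobstructed_pairs :: "int \<Rightarrow> (('x list \<times> 'x list) \<times> 'x list) set" where
  "unobstructed_pairs n = {((w, t), s). chain X F n w t \<and> t @ s \<in> normals}"

definition obstructed_pairs :: "int \<Rightarrow> (('x list \<times> 'x list) \<times> 'x list) set" where
  "obstructed_pairs n = {((w, t), s). chain X F n w t \<and> s \<in> normals \<and> t @ s \<notin> normals}"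

lemma finite_words: "S \<subseteq> lists X \<Longrightarrow> finite {w \<in> S. wdeg w = n}"
  by (rule finite_subset[OF _ finite_words_degree_le[OF degree_pos degree_finite, of n]]) auto

lemma normals_lists: "normals \<subseteq> lists X"
  by (auto simp: normal_words_def)

lemma finite_chains: "finite {c \<in> chain_pairs n. chain_deg c = m}"
proof -
  have "inj_on fst {c \<in> chain_pairs n. chain_deg c = m}"
    by (auto simp: inj_on_def dest: chain_tail_unique)
  moreover have "fst ` {c \<in> chain_pairs n. chain_deg c = m} \<subseteq> {w \<in> lists X. wdeg w = m}"
    by (auto dest: chain_props)
  ultimately show ?thesis
    using finite_words[OF order_refl, of m] by (meson finite_imageD finite_subset)
qed

lemma finite_pairs: "finite {p \<in> chain_pairs n \<times> normals. pair_deg p = m}"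
proof (rule finite_subset)
  show "{p \<in> chain_pairs n \<times> normals. pair_deg p = m} \<subseteq>
      (\<Union>i\<in>{..m}. {c \<in> chain_pairs n. chain_deg c = i}) \<times> (\<Union>i\<in>{..m}. {s \<in> normals. wdeg s = i})"
    by auto
qed (use finite_chains finite_words[OF normals_lists] in auto)

text \<open>Chains are carried with their tails so that the matching can be stated; as a word
  determines its tail, nothing is counted twice.\<close>

lemma weight_series_chains:
  "weight_series chain_deg (chain_pairs n) = weight_series wdeg {w. \<exists>t. chain X F n w t}"
proof (rule weight_series_bij_betw)
  show "bij_betw fst (chain_pairs n) {w. \<exists>t. chain X F n w t}"
    unfolding bij_betw_def inj_on_def by (auto dest: chain_tail_unique simp: image_iff)
qed auto

lemma chains_times_normals:
  "weight_series chain_deg (chain_pairs n) * weight_series wdeg normals =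
    weight_series pair_deg (unobstructed_pairs n) + weight_series pair_deg (obstructed_pairs n)"
proof -
  have eq: "chain_pairs n \<times> normals = unobstructed_pairs n \<union> obstructed_pairs n"
    using normal_words_sublist[OF _ sublist_append_leftI]
    unfolding unobstructed_pairs_def obstructed_pairs_def by blast
  have "weight_series chain_deg (chain_pairs n) * weight_series wdeg normals =
      weight_series pair_deg (chain_pairs n \<times> normals)"
    by (rule weight_series_Times[symmetric]) (fact finite_chains finite_words[OF normals_lists])+
  also have "\<dots> = weight_series pair_deg (unobstructed_pairs n) + weight_series pair_deg (obstructed_pairs n)"
    unfolding eq
  proof (rule weight_series_Un)
    show "unobstructed_pairs n \<inter> obstructed_pairs n = {}" by (auto simp: unobstructed_pairs_def obstructed_pairs_def)
    show "finite {p \<in> unobstructed_pairs n. pair_deg p = m}" "finite {p \<in> obstructed_pairs n. pair_deg p = m}" for m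
      by (rule finite_subset[OF _ finite_pairs[of n m]], use eq in blast)+
  qed
  finally show ?thesis .
qed

text \<open>The map moves the tail of the chain to the normal word; its inverse cuts off the shortest
  prefix that completes an obstruction.\<close>

lemma weight_series_unobstructed_pairs_Suc:
  assumes "n \<ge> 0"
  shows "weight_series pair_deg (unobstructed_pairs (n + 1)) = weight_series pair_deg (obstructed_pairs n)"
proof (rule weight_series_bij_betw)
  \<comment> \<open>Dropping the tail leaves the underlying \<open>n\<close>-chain, whose own tail
    is not recorded in the pair; the description \<open>THE\<close> recovers it, legitimately by
    \<open>chain_tail_unique\<close>.\<close>
  let ?f = "\<lambda>((w, t), s). ((take (length w - length t) w,
    THE r. chain X F n (take (length w - length t) w) r), t @ s)"
  have f: "?f ((g @ t, t), s) = ((g, r), t @ s)" if "chain X F n g r" for g r t s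
    using that by (auto intro!: the_equality dest: chain_tail_unique)
  \<comment> \<open>Here \<open>n \<ge> 0\<close> matters: it excludes 0-chains, which do not arise
    by extending the (-1)-chain.\<close>
  have step: "\<exists>g r. w = g @ t \<and> chain X F n g r \<and> single_final_occurrence F (r @ t)"
    if "chain X F (n + 1) w t" for w t
    using that by cases (use assms in auto)
  have inj: "inj_on ?f (unobstructed_pairs (n + 1))"
  proof (rule inj_onI)
    fix p q assume pq: "p \<in> unobstructed_pairs (n + 1)" "q \<in> unobstructed_pairs (n + 1)" "?f p = ?f q"
    obtain w t s w' t' s' where p: "p = ((w, t), s)" and q: "q = ((w', t'), s')"
      by (metis prod.collapse)
    obtain g r where g: "w = g @ t" "chain X F n g r" "single_final_occurrence F (r @ t)"
      using step[of w t] pq(1) p by (auto simp: unobstructed_pairs_def)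
    obtain g' r' where g': "w' = g' @ t'" "chain X F n g' r'" "single_final_occurrence F (r' @ t')"
      using step[of w' t'] pq(2) q by (auto simp: unobstructed_pairs_def)
    have eq: "g = g'" "r = r'" "t @ s = t' @ s'"
      using pq(3) f[OF g(2), of t s] f[OF g'(2), of t' s'] unfolding p q g(1) g'(1) by auto
    \<comment> \<open>Both \<open>r @ t\<close> and \<open>r @ t'\<close> are shortest obstructed
      prefixes of \<open>r @ t @ s\<close>, hence equal.\<close>
    have "prefix t (t @ s)" "prefix t' (t @ s)"
      unfolding prefix_def using eq(3) by blast+
    then have "r @ t = r @ t'"
      using single_final_occurrence_unique[of "r @ t" "r @ t'" "r @ t @ s"] g g' eq(2) by simp
    with eq g g' p q show "p = q" by auto
  qed
  have "?f ` unobstructed_pairs (n + 1) = obstructed_pairs n"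
  proof (intro equalityI subsetI)
    fix b assume "b \<in> ?f ` unobstructed_pairs (n + 1)"
    then obtain w t s where b: "b = ?f ((w, t), s)" and wts: "((w, t), s) \<in> unobstructed_pairs (n + 1)"
      by auto
    obtain g r where g: "w = g @ t" "chain X F n g r" "single_final_occurrence F (r @ t)"
      using step[of w t] wts by (auto simp: unobstructed_pairs_def)
    obtain f' where "f' \<in> F" "suffix f' (r @ t)"
      using g(3) unfolding single_final_occurrence_iff by blast
    then have "f' \<in> F" "sublist f' (r @ t @ s)"
      by (auto simp: suffix_def sublist_def) (metis append.assoc)
    then have "r @ t @ s \<notin> normals" by (auto simp: normal_words_def)
    then show "b \<in> obstructed_pairs n"
      unfolding b g(1) f[OF g(2)] using g(2) wts by (simp add: obstructed_pairs_def unobstructed_pairs_def)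
  next
    fix b assume "b \<in> obstructed_pairs n"
    then obtain g r u where b: "b = ((g, r), u)" and gru: "chain X F n g r" "u \<in> normals"
      "r @ u \<notin> normals"
      by (auto simp: obstructed_pairs_def)
    have "r \<in> lists X" "u \<in> lists X"
      using chain_props[OF gru(1)] gru(2) by (auto simp: suffix_def normal_words_def)
    then obtain f' where "f' \<in> F" "sublist f' (r @ u)"
      using gru(3) by (auto simp: normal_words_def)
    then obtain t s where ts: "u = t @ s" "single_final_occurrence F (r @ t)"
      using single_final_occurrence_extension chain_tail_strict_prefix[OF gru(1)] by metis
    have "t \<in> normals" using gru(2) ts(1) normal_words_sublist by blast
    then have "chain X F (n + 1) (g @ t) t"
      using chain.step[of "n + 1" X F g r t] assms gru ts by simp
    then have "((g @ t, t), s) \<in> unobstructed_pairs (n + 1)"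
      using gru ts by (simp add: unobstructed_pairs_def)
    moreover have "b = ?f ((g @ t, t), s)"
      unfolding f[OF gru(1)] b ts(1) ..
    ultimately show "b \<in> ?f ` unobstructed_pairs (n + 1)" by (rule rev_image_eqI)
  qed
  with inj show "bij_betw ?f (unobstructed_pairs (n + 1)) (obstructed_pairs n)"
    by (simp add: bij_betw_def)
  show "pair_deg (?f p) = pair_deg p" if "p \<in> unobstructed_pairs (n + 1)" for p
  proof -
    obtain w t s where p: "p = ((w, t), s)" by (metis prod.collapse)
    then obtain g r where g: "w = g @ t" "chain X F n g r"
      using step[of w t] \<open>p \<in> unobstructed_pairs (n + 1)\<close> by (auto simp: unobstructed_pairs_def)
    show ?thesis unfolding p g(1) f[OF g(2)] by simp
  qed
qed

text \<open>The base of the telescope: a nonempty normal word is cut after its first letter, which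
  is a 0-chain and its own tail.\<close>

lemma weight_series_normals:
  "weight_series wdeg normals = 1 + weight_series pair_deg (unobstructed_pairs 0)"
proof -
  have chain0: "chain X F 0 w t \<longleftrightarrow> (\<exists>x\<in>X. w = [x] \<and> t = [x])" for w t
    by (auto intro: chain.letter elim: chain.cases)
  have "[] \<in> normals" using Nil_not_obstruction by (auto simp: normal_words_def)
  then have "normals = {[]} \<union> (normals - {[]})" by auto
  then have "weight_series wdeg normals = weight_series wdeg ({[]} \<union> (normals - {[]}))"
    by simp
  also have "\<dots> = weight_series wdeg {[]} + weight_series wdeg (normals - {[]})"
    by (rule weight_series_Un) (use normals_lists in \<open>auto intro!: finite_words simp del: Diff_iff\<close>)
  also have "weight_series wdeg {[] :: 'x list} = 1" by (rule weight_series_Nil)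
  also have "weight_series wdeg (normals - {[]}) = weight_series pair_deg (unobstructed_pairs 0)"
  proof (rule weight_series_bij_betw[where f = "\<lambda>v. (([hd v], [hd v]), tl v)"])
    show "bij_betw (\<lambda>v. (([hd v], [hd v]), tl v)) (normals - {[]}) (unobstructed_pairs 0)"
      by (rule bij_betw_byWitness[where f' = "\<lambda>((w, t), s). t @ s"])
        (auto simp: unobstructed_pairs_def chain0 neq_Nil_conv normal_words_def)
  qed (auto simp: neq_Nil_conv)
  finally show ?thesis .
qed

lemma weight_series_chains_nth_eq_0:
  assumes "int m < n"
  shows "weight_series chain_deg (chain_pairs n) $ m = 0"
proof -
  have "n \<le> int (wdeg w)" if "chain X F n w t" for w t
    using chain_props[OF that] length_le_word_degree[of X d w, OF degree_pos] by force
  with assms have "{c \<in> chain_pairs n. chain_deg c = m} = {}" by fastforce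
  then show ?thesis unfolding weight_series_nth by (simp only: card.empty of_nat_0)
qed

lemma weight_series_unobstructed_pairs_nth_eq_0:
  assumes "int m < n"
  shows "weight_series pair_deg (unobstructed_pairs n) $ m = 0"
proof -
  have "n \<le> int (wdeg w)" if "chain X F n w t" for w t
    using chain_props[OF that] length_le_word_degree[of X d w, OF degree_pos] by force
  with assms have "{c \<in> unobstructed_pairs n. pair_deg c = m} = {}" by (fastforce simp: unobstructed_pairs_def)
  then show ?thesis unfolding weight_series_nth by (simp only: card.empty of_nat_0)
qed

text \<open>The (-1)-chain contributes 1 + U_0, and the \<open>n\<close>-chains with
  \<open>n \<ge> 0\<close> contribute U_n + U_(n+1), since the obstructed pairs for \<open>n\<close>
  match the unobstructed ones for \<open>n + 1\<close>. With alternating signs only 1 and the last U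
  survive.\<close>

lemma chains_alternating_sum:
  "(\<Sum>k<K+1. (-1) ^ k * weight_series chain_deg (chain_pairs (int k - 1))) * weight_series wdeg normals =
    1 - (-1) ^ (K + 1) * weight_series pair_deg (unobstructed_pairs (int K))"
proof (induction K)
  case 0
  have "chain_pairs (- 1) = {([], [])}" by (auto intro: chain.empty elim: chain.cases)
  then have "weight_series chain_deg (chain_pairs (- 1)) = 1"
    by (intro fps_ext) (auto simp: weight_series_nth Collect_conv_if)
  then show ?case by (simp add: weight_series_normals)
next
  case (Suc K)
  have "weight_series chain_deg (chain_pairs (int K)) * weight_series wdeg normals =
      weight_series pair_deg (unobstructed_pairs (int K)) + weight_series pair_deg (unobstructed_pairs (int (Suc K)))"
    using weight_series_unobstructed_pairs_Suc[of "int K"] by (simp add: chains_times_normals add.commute)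
  then show ?case using Suc.IH
    by (simp add: algebra_simps)
qed

lemma chains_normals_inverse:
  defines "f \<equiv> \<lambda>k. (-1) ^ k * weight_series wdeg {w. \<exists>t. chain X F (int k - 1) w t}"
  shows "summable f" and "weight_series wdeg normals = inverse (suminf f)"
proof -
  have f: "f = (\<lambda>k. (-1) ^ k * weight_series chain_deg (chain_pairs (int k - 1)))"
    unfolding f_def weight_series_chains ..
  have neg1: "(-1 :: rat fps) ^ k = fps_const ((-1) ^ k)" for k
    by (induction k) (simp_all flip: fps_const_neg)
  have zero: "f k $ m = 0" if "k > Suc m" for k m
    using that weight_series_chains_nth_eq_0[of m "int k - 1"] unfolding f neg1 by simp
  let ?S = "Abs_fps (\<lambda>m. \<Sum>k<m+2. f k $ m)"
  have sums: "f sums ?S" by (rule fps_sums_locally_finite) (fact zero)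
  then show "summable f" by (rule sums_summable)
  have "?S * weight_series wdeg normals = 1"
  proof (rule fps_ext)
    fix m
    \<comment> \<open>Coefficient \<open>m\<close> of the product sees only coefficients up to
      \<open>m\<close> of \<open>?S\<close>, so a finite partial sum can replace it. Its length is
      chosen so that the error term is U_(m+1), which vanishes in degree \<open>m\<close>.\<close>
    have "?S $ i = (\<Sum>k<m+1+1. f k) $ i" if "i \<le> m" for i
      unfolding fps_sum_nth fps_nth_Abs_fps by (rule sum.mono_neutral_left) (use that zero in auto)
    then have "(?S * weight_series wdeg normals) $ m =
        ((\<Sum>k<m+1+1. f k) * weight_series wdeg normals) $ m"
      by (simp add: fps_mult_nth)
    also have "\<dots> = (1 - (-1) ^ (m + 2) * weight_series pair_deg (unobstructed_pairs (int (m + 1)))) $ m"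
      using chains_alternating_sum[of "m + 1"] unfolding f by simp
    also have "\<dots> = 1 $ m"
      using weight_series_unobstructed_pairs_nth_eq_0[of m "int (m + 1)"] unfolding neg1 by simp
    finally show "(?S * weight_series wdeg normals) $ m = 1 $ m" .
  qed
  with sums_unique[OF sums] show "weight_series wdeg normals = inverse (suminf f)"
    by (metis fps_inverse_unique inverse_inverse_eq)
qed

end

section \<open>Spans of words and their dimension\<close>

lemma carrier_free_algebra: "carrier (free_algebra X) = word_span (lists X)"
  by (simp add: free_algebra_def)

lemma free_algebra_simps [simp]:
  "f \<otimes>\<^bsub>free_algebra X\<^esub> g = f * g" "f \<oplus>\<^bsub>free_algebra X\<^esub> g = f + g"
  "\<one>\<^bsub>free_algebra X\<^esub> = 1" "\<zero>\<^bsub>free_algebra X\<^esub> = 0"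
  by (simp_all add: free_algebra_def)

lemma word_span_mono: "S \<subseteq> T \<Longrightarrow> word_span S \<subseteq> word_span T"
  by (auto simp: word_span_def)

lemma zero_in_word_span [simp]: "0 \<in> word_span S"
  by (simp add: word_span_def)

lemma single_in_word_span: "w \<in> S \<Longrightarrow> Poly_Mapping.single w c \<in> word_span S"
  by (simp add: word_span_def)

lemma add_in_word_span:
  "f \<in> word_span S \<Longrightarrow> g \<in> word_span S \<Longrightarrow> (f + g :: _ \<Rightarrow>\<^sub>0 'k::monoid_add) \<in> word_span S"
  unfolding word_span_def using Poly_Mapping.keys_add[of f g] by auto

lemma diff_in_word_span:
  "f \<in> word_span S \<Longrightarrow> g \<in> word_span S \<Longrightarrow> (f - g :: _ \<Rightarrow>\<^sub>0 'k::ab_group_add) \<in> word_span S"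
  unfolding word_span_def using keys_diff[of f g] by auto

lemma word_span_induct [consumes 1, case_names zero add]:
  fixes f :: "'x list \<Rightarrow>\<^sub>0 'k::monoid_add"
  assumes "f \<in> word_span S" and "P 0"
    and add: "\<And>w c f. w \<in> S \<Longrightarrow> f \<in> word_span S \<Longrightarrow> P f \<Longrightarrow> P (Poly_Mapping.single w c + f)"
  shows "P f"
  using assms(1)
proof (induction f rule: update_induct)
  case const
  show ?case by (fact assms(2))
next
  case (update f w c)
  have "Poly_Mapping.update w c f = Poly_Mapping.single w c + f"
    using update.hyps
    by (intro poly_mapping_eqI) (auto simp: lookup_update lookup_add lookup_single in_keys_iff when_def)
  moreover have "w \<in> S" "f \<in> word_span S"
    using update.prems update.hyps by (auto simp: word_span_def keys_update)
  ultimately show ?case using update.IH add by simp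
qed

lemma single_mult_single:
  fixes a b :: "'k::field"
  shows "Poly_Mapping.single u a * Poly_Mapping.single v b = Poly_Mapping.single (u @ v) (a * b)"
  by (simp add: mult_single plus_list_def)

lemma one_eq_single: "(1 :: 'x list \<Rightarrow>\<^sub>0 'k::field) = Poly_Mapping.single [] 1"
  by (simp add: zero_list_def flip: single_one)

lemma base_field_eq_word_span: "base_field = word_span {[]}"
proof (intro equalityI subsetI)
  fix f :: "'x list \<Rightarrow>\<^sub>0 'k::field" assume "f \<in> word_span {[]}"
  then have "f = Poly_Mapping.single [] (Poly_Mapping.lookup f [])"
    by (intro poly_mapping_eqI) (auto simp: lookup_single word_span_def in_keys_iff when_def)
  then show "f \<in> base_field" unfolding base_field_def by (rule range_eqI)
qed (auto simp: base_field_def single_in_word_span)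

lemma subfield_base_field: "subfield base_field (free_algebra X :: ('x list \<Rightarrow>\<^sub>0 'k::field) ring)"
proof -
  let ?A = "free_algebra X :: ('x list \<Rightarrow>\<^sub>0 'k) ring"
  interpret ring ?A by (rule ring_free_algebra)
  have sub: "base_field \<subseteq> carrier ?A"
    unfolding base_field_eq_word_span carrier_free_algebra by (rule word_span_mono) auto
  have subring: "subring base_field ?A"
  proof (rule subringI)
    fix h assume h: "h \<in> (base_field :: ('x list \<Rightarrow>\<^sub>0 'k) set)"
    then have "- h \<in> base_field"
      by (auto simp: base_field_def simp flip: single_uminus)
    moreover have "\<ominus>\<^bsub>?A\<^esub> h = - h"
      using h \<open>- h \<in> base_field\<close> sub by (intro minus_equality) auto
    ultimately show "\<ominus>\<^bsub>?A\<^esub> h \<in> base_field" by simp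
  qed (use sub in \<open>auto simp: base_field_def one_eq_single single_mult_single simp flip: single_add\<close>)
  show ?thesis
  proof (rule subfieldI)
    show "subcring base_field ?A"
      by (rule subcringI) (use subring in \<open>auto simp: base_field_def single_mult_single mult.commute\<close>)
    have "Poly_Mapping.single [] c \<in> Units (?A\<lparr>carrier := base_field\<rparr>)" if "c \<noteq> 0" for c :: 'k
      unfolding Units_def using that
      by (auto simp: base_field_def one_eq_single single_mult_single
          intro!: exI[of _ "inverse c"])
    moreover have "0 \<notin> Units (?A\<lparr>carrier := base_field\<rparr>)"
      by (auto simp: Units_def)
    ultimately show "Units (?A\<lparr>carrier := base_field\<rparr>) = base_field - {\<zero>\<^bsub>?A\<^esub>}"
      by (auto simp: base_field_def Units_def) (metis single_zero)
  qed
qed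

text \<open>Serves two maps: the identity of the free algebra, for the spans of chains, and the
  residue map onto the presented algebra. The condition \<open>one_not_zero\<close> makes the image
  of the constants a field, over which dimensions are taken.\<close>

locale free_algebra_hom = ring_hom_ring "free_algebra X" A h
  for X :: "'x set" and A :: "('a, 'b) ring_scheme" (structure)
    and h :: "('x list \<Rightarrow>\<^sub>0 'k::field) \<Rightarrow> 'a" +
  assumes one_not_zero: "\<one> \<noteq> \<zero>"
begin

abbreviation "scalars \<equiv> h ` base_field"

lemma subfield_scalars: "subfield scalars A"
  by (rule img_is_subfield(2)[OF subfield_base_field one_not_zero])

lemma single_carrier: "w \<in> lists X \<Longrightarrow> Poly_Mapping.single w c \<in> carrier (free_algebra X)"
  unfolding carrier_free_algebra by (rule single_in_word_span)

lemma hom_add_free: "f \<in> word_span (lists X) \<Longrightarrow> g \<in> word_span (lists X) \<Longrightarrow> h (f + g) = h f \<oplus> h g"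
  using hom_add[of f g] by (simp add: carrier_free_algebra)

lemma hom_single:
  assumes "w \<in> lists X"
  shows "h (Poly_Mapping.single w c) = h (Poly_Mapping.single [] c) \<otimes> h (Poly_Mapping.single w 1)"
  using hom_mult[of "Poly_Mapping.single [] c" "Poly_Mapping.single w 1"] assms
  by (simp add: single_carrier single_mult_single)

lemma hom_eq_iff:
  assumes "f \<in> word_span (lists X)" "g \<in> word_span (lists X)"
  shows "h f = h g \<longleftrightarrow> h (f - g) = \<zero>"
proof -
  have fg: "f - g \<in> word_span (lists X)" using assms by (rule diff_in_word_span)
  have closed: "h f \<in> carrier A" "h g \<in> carrier A" "h (f - g) \<in> carrier A"
    using assms fg by (simp_all flip: carrier_free_algebra)
  have "h f = h (f - g) \<oplus> h g"
    using hom_add_free[OF fg assms(2)] by simp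
  then show ?thesis
    using closed by (metis S.add.r_cancel_one' S.l_zero)
qed

text \<open>The kernel condition expresses linear independence of the images of the words in
  \<open>S\<close>; each further word then contributes one new line.\<close>

lemma dimension_word_span:
  assumes "finite S" "S \<subseteq> lists X" "\<And>f. f \<in> word_span S \<Longrightarrow> h f = \<zero> \<Longrightarrow> f = 0"
  shows "dimension (card S) scalars (h ` word_span S)"
  using assms
proof (induction S)
  case empty
  have "word_span {} = {0 :: 'x list \<Rightarrow>\<^sub>0 'k}" by (auto simp: word_span_def)
  moreover have "h 0 = \<zero>" using hom_zero by simp
  ultimately show ?case by simp
next
  case (insert w S)
  let ?w = "Poly_Mapping.single w (1 :: 'k)"
  have w: "w \<in> lists X" and S: "S \<subseteq> lists X" using insert.prems by auto
  have mono: "word_span S \<subseteq> (word_span (insert w S) :: ('x list \<Rightarrow>\<^sub>0 'k) set)"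
    by (rule word_span_mono) auto
  \<comment> \<open>Otherwise \<open>?w - f\<close> would be a kernel element for some
    \<open>f\<close> over \<open>S\<close>, forcing \<open>?w = f\<close> although \<open>w\<close>
    does not occur in \<open>f\<close>.\<close>
  have "h ?w \<notin> h ` word_span S"
  proof
    assume "h ?w \<in> h ` word_span S"
    then obtain f where f: "f \<in> word_span S" "h ?w = h f" by auto
    have "f \<in> word_span (lists X)" "?w \<in> word_span (lists X)"
      using f(1) w word_span_mono[OF S] by (auto intro: single_in_word_span)
    with f(2) have "h (?w - f) = \<zero>" using hom_eq_iff by blast
    moreover have "?w - f \<in> word_span (insert w S)"
      using f(1) mono by (auto intro: diff_in_word_span single_in_word_span)
    ultimately have "?w - f = 0" using insert.prems(2) by blast
    then have "?w = f" by simp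
    with f(1) insert.hyps(2) show False by (auto simp: word_span_def)
  qed
  moreover have "h ?w \<in> carrier A" using w by (simp add: single_carrier)
  moreover have "dimension (card S) scalars (h ` word_span S)"
  proof (rule insert.IH[OF S])
    show "f = 0" if "f \<in> word_span S" "h f = \<zero>" for f
      using that mono insert.prems(2) by blast
  qed
  ultimately have "dimension (Suc (card S)) scalars (line_extension scalars (h ?w) (h ` word_span S))"
    by (intro S.dimension.Suc_dim)
  also have "line_extension scalars (h ?w) (h ` word_span S) = h ` word_span (insert w S)"
  proof -
    have eq: "h (Poly_Mapping.single w c + f) = h (Poly_Mapping.single [] c) \<otimes> h ?w \<oplus> h f"
      if "f \<in> word_span S" for c f
      unfolding hom_single[OF w, of c, symmetric]
      by (rule hom_add_free) (use that w word_span_mono[OF S] in \<open>auto intro: single_in_word_span\<close>)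
    have split: "\<exists>c g. g \<in> word_span S \<and> f = Poly_Mapping.single w c + g"
      if "f \<in> word_span (insert w S)" for f :: "'x list \<Rightarrow>\<^sub>0 'k"
    proof (intro exI conjI)
      let ?g = "f - Poly_Mapping.single w (Poly_Mapping.lookup f w)"
      show "f = Poly_Mapping.single w (Poly_Mapping.lookup f w) + ?g" by simp
      show "?g \<in> word_span S"
        using that by (auto simp: word_span_def in_keys_iff lookup_minus lookup_single when_def
            split: if_splits)
    qed
    have closed: "Poly_Mapping.single w c + g \<in> word_span (insert w S)" if "g \<in> word_span S"
      for c and g :: "'x list \<Rightarrow>\<^sub>0 'k"
      using that mono by (auto intro: add_in_word_span single_in_word_span)
    show ?thesis
    proof (intro equalityI subsetI)
      fix a assume "a \<in> line_extension scalars (h ?w) (h ` word_span S)"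
      then obtain c f where "f \<in> word_span S" "a = h (Poly_Mapping.single [] c) \<otimes> h ?w \<oplus> h f"
        unfolding S.line_extension_mem_iff base_field_def by blast
      then show "a \<in> h ` word_span (insert w S)" using eq closed by (metis imageI)
    next
      fix a assume "a \<in> h ` word_span (insert w S)"
      then obtain c g where "g \<in> word_span S" "a = h (Poly_Mapping.single w c + g)"
        using split by blast
      then show "a \<in> line_extension scalars (h ?w) (h ` word_span S)"
        unfolding S.line_extension_mem_iff base_field_def using eq by blast
    qed
  qed
  finally show ?case using insert.hyps by simp
qed

lemma hilbert_series_word_span:
  assumes "\<And>n. finite (S n)" "\<And>n. S n \<subseteq> lists X"
    and "\<And>n f. f \<in> word_span (S n) \<Longrightarrow> h f = \<zero> \<Longrightarrow> f = 0"
  shows "hilbert_series A scalars (\<lambda>n. h ` word_span (S n)) $ n = of_nat (card (S n))"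
proof -
  have "dim scalars (h ` word_span (S n)) = card (S n)"
    using dimI[OF subfield_scalars dimension_word_span] assms by (simp add: over_def)
  then show ?thesis by (simp add: hilbert_series_def)
qed

end

lemma hilbert_series_subspace_word_span:
  fixes T :: "'x list set"
  assumes pos: "\<And>x. x \<in> X \<Longrightarrow> d x > 0" and fin: "\<And>n. finite {x \<in> X. d x = n}" and T: "T \<subseteq> lists X"
  shows "hilbert_series_subspace X d (word_span T :: ('x list \<Rightarrow>\<^sub>0 'k::field) set) =
    weight_series (word_degree d) T"
proof (rule fps_ext)
  fix n
  let ?A = "free_algebra X :: ('x list \<Rightarrow>\<^sub>0 'k) ring"
  interpret free_algebra_hom X ?A id
    by (intro free_algebra_hom.intro ring_hom_ringI2 ring_free_algebra free_algebra_hom_axioms.intro)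
      (auto simp: ring_hom_def)
  have *: "hilbert_series ?A (id ` base_field) (\<lambda>n. id ` word_span {w \<in> T. word_degree d w = n}) $ n =
      of_nat (card {w \<in> T. word_degree d w = n})"
  proof (rule hilbert_series_word_span)
    fix n
    show "finite {w \<in> T. word_degree d w = n}"
      by (rule finite_subset[OF _ finite_words_degree_le[OF pos fin, of n]]) (use T in auto)
  qed (use T in auto)
  have "word_span T \<inter> word_span {w. word_degree d w = n} =
      (word_span {w \<in> T. word_degree d w = n} :: ('x list \<Rightarrow>\<^sub>0 'k) set)" for n
    by (auto simp: word_span_def)
  with * show "hilbert_series_subspace X d (word_span T :: ('x list \<Rightarrow>\<^sub>0 'k) set) $ n =
      weight_series (word_degree d) T $ n"
    by (simp add: hilbert_series_subspace_def weight_series_nth)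
qed

section \<open>Normal forms\<close>

text \<open>Justifies the description in \<open>LT\<close>: the support is finite and nonempty, so
  it has a greatest word, unique by antisymmetry.\<close>

lemma LT_props:
  assumes r: "well_order_on (lists X) r" and f: "f \<in> word_span (lists X)" "f \<noteq> 0"
  shows "LT r f \<in> Poly_Mapping.keys f \<and> (\<forall>m\<in>Poly_Mapping.keys f. (m, LT r f) \<in> r)"
proof -
  have lin: "refl_on (lists X) r" "trans r" "antisym r" "total_on (lists X) r"
    using r by (auto simp: order_on_defs)
  have max: "\<exists>m\<in>M. \<forall>m'\<in>M. (m', m) \<in> r" if "finite M" "M \<noteq> {}" "M \<subseteq> lists X" for M
    using that
  proof (induction rule: finite_ne_induct)
    case (singleton w)
    then show ?case using lin(1) by (auto dest: refl_onD)
  next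
    case (insert w M)
    then obtain m where m: "m \<in> M" "\<forall>m'\<in>M. (m', m) \<in> r" by auto
    have "(w, w) \<in> r" using insert.prems lin(1) by (auto dest: refl_onD)
    moreover have "w \<in> lists X" "m \<in> lists X" "w \<noteq> m"
      using insert.prems insert.hyps m(1) by auto
    then have "(w, m) \<in> r \<or> (m, w) \<in> r"
      using lin(4) unfolding total_on_def by blast
    ultimately show ?case
      using m transD[OF lin(2), of _ m w] by (metis insert_iff)
  qed
  have "finite (Poly_Mapping.keys f)" "Poly_Mapping.keys f \<noteq> {}"
    "Poly_Mapping.keys f \<subseteq> lists X"
    using f by (simp_all add: word_span_def)
  from max[OF this] obtain m
    where "m \<in> Poly_Mapping.keys f" "\<forall>m'\<in>Poly_Mapping.keys f. (m', m) \<in> r"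
    by blast
  then have "\<exists>!m. m \<in> Poly_Mapping.keys f \<and> (\<forall>m'\<in>Poly_Mapping.keys f. (m', m) \<in> r)"
    using lin(3) by (auto dest: antisymD)
  then show ?thesis unfolding LT_def by (rule theI')
qed

text \<open>The independence half of the normal form theorem: the leading word of a nonzero ideal
  element contains an obstruction, whereas every word of \<open>f\<close> is normal.\<close>

lemma normal_word_span_Int_ideal:
  assumes r: "well_order_on (lists X) r" and G: "groebner_basis r I G"
    and f: "f \<in> word_span (normal_words X (LT r ` G))" "f \<in> I"
  shows "f = 0"
proof (rule ccontr)
  assume nz: "f \<noteq> 0"
  have "f \<in> word_span (lists X)"
    using f(1) by (auto simp: word_span_def normal_words_def)
  then have "LT r f \<in> normal_words X (LT r ` G)"
    using LT_props[OF r _ nz] f(1) by (auto simp: word_span_def)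
  moreover obtain g where "g \<in> G" "sublist (LT r g) (LT r f)"
    using G f(2) nz unfolding groebner_basis_def by blast
  ultimately show False by (auto simp: normal_words_def)
qed

locale free_algebra_ideal = ideal I "free_algebra X :: ('x list \<Rightarrow>\<^sub>0 'k::field) ring"
  for X :: "'x set" and I
begin

lemma ideal_subset: "I \<subseteq> word_span (lists X)"
  using a_subset by (simp add: carrier_free_algebra)

lemma ideal_add: "f \<in> I \<Longrightarrow> g \<in> I \<Longrightarrow> f + g \<in> I"
  using additive_subgroup.a_closed[OF is_additive_subgroup, of f g] by simp

lemma ideal_zero: "0 \<in> I"
  using additive_subgroup.zero_closed[OF is_additive_subgroup] by simp

lemma ideal_mult: "f \<in> I \<Longrightarrow> u \<in> word_span (lists X) \<Longrightarrow> v \<in> word_span (lists X) \<Longrightarrow> u * f * v \<in> I"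
  using I_l_closed[of f u] I_r_closed[of "u * f" v] by (simp add: carrier_free_algebra)

lemma ideal_scale:
  "f \<in> I \<Longrightarrow> Poly_Mapping.single [] c * f \<in> I"
  using ideal_mult[of f "Poly_Mapping.single [] c" 1]
  by (simp add: one_eq_single single_in_word_span) (simp flip: one_eq_single)

text \<open>The set \<open>S\<close> is kept general because the lemma is applied twice: to the
  words below a given word, inside the well-founded induction, and finally to all words.\<close>

lemma normal_form_linear:
  assumes words: "\<And>w. w \<in> S \<Longrightarrow> \<exists>f\<in>word_span N. Poly_Mapping.single w 1 - f \<in> I"
    and "f \<in> word_span S"
  shows "\<exists>f'\<in>word_span N. f - f' \<in> I"
  using assms(2)
proof (induction rule: word_span_induct)
  case zero
  show ?case using ideal_zero by (intro bexI[of _ 0]) auto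
next
  case (add w c f)
  then obtain f' where f': "f' \<in> word_span N" "f - f' \<in> I" by blast
  obtain g where g: "g \<in> word_span N" "Poly_Mapping.single w 1 - g \<in> I"
    using words add by blast
  let ?c = "Poly_Mapping.single [] c"
  have cg: "?c * g \<in> word_span N"
    using g(1) Poly_Mapping.keys_mult[of ?c g]
    by (auto simp: word_span_def plus_list_def split: if_splits)
  have "Poly_Mapping.single w c + f - (?c * g + f') = ?c * (Poly_Mapping.single w 1 - g) + (f - f')"
    by (simp add: algebra_simps single_mult_single)
  also have "\<dots> \<in> I" using f'(2) g(2) by (intro ideal_add ideal_scale)
  finally show ?case using cg f'(1) add_in_word_span by blast
qed

text \<open>The spanning half, by well-founded induction on words. A word containing the leading
  term of \<open>g\<close> is congruent modulo \<open>I\<close> to a combination of smaller words,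
  obtained by replacing that leading term with minus the rest of \<open>g\<close>; \<open>g\<close>
  being monic makes it cancel.\<close>

lemma normal_form_exists:
  assumes r: "admissible_order X r" and G: "groebner_basis r I G"
    and monic: "\<And>g. g \<in> G \<Longrightarrow> LC r g = 1"
    and f: "f \<in> word_span (lists X)"
  shows "\<exists>f'\<in>word_span (normal_words X (LT r ` G)). f - f' \<in> I"
proof -
  let ?N = "normal_words X (LT r ` G)"
  have wo: "well_order_on (lists X) r" using r by (simp add: admissible_order_def)
  then have "wf (r - Id)" by (simp add: well_order_on_def)
  then have "w \<in> lists X \<longrightarrow> (\<exists>f\<in>word_span ?N. Poly_Mapping.single w (1 :: 'k) - f \<in> I)" for w
  proof (induction w rule: wf_induct_rule)
    case (less w)
    show ?case
    proof (intro impI)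
      assume w: "w \<in> lists X"
      show "\<exists>f\<in>word_span ?N. Poly_Mapping.single w 1 - f \<in> I"
      proof (cases "w \<in> ?N")
        case True
        then show ?thesis
          using ideal_zero by (intro bexI[of _ "Poly_Mapping.single w 1"]) (auto intro: single_in_word_span)
      next
        case False
        then obtain g u v where g: "g \<in> G" and uv: "w = u @ LT r g @ v"
          using w by (auto simp: normal_words_def sublist_def)
        have gI: "g \<in> I" using G g by (auto simp: groebner_basis_def)
        have gX: "g \<in> word_span (lists X)" using gI ideal_subset by blast
        have lc: "Poly_Mapping.lookup g (LT r g) = 1"
          using monic[OF g] by (simp add: LC_def)
        then have nz: "g \<noteq> 0" by auto
        have u: "u \<in> lists X" and v: "v \<in> lists X" using w uv by auto
        let ?u = "Poly_Mapping.single u (1 :: 'k)" and ?v = "Poly_Mapping.single v (1 :: 'k)"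
        let ?g = "Poly_Mapping.single (LT r g) 1 - g"
        let ?S = "{m \<in> lists X. (m, w) \<in> r - Id}"
        have keys: "Poly_Mapping.keys ?g \<subseteq> Poly_Mapping.keys g - {LT r g}"
          using lc by (auto simp: in_keys_iff lookup_minus lookup_single when_def split: if_splits)
        \<comment> \<open>Two-sided compatibility of the order is used here: the words of
          \<open>?g\<close> stay below the leading term after multiplication by \<open>u\<close> on
          the left and \<open>v\<close> on the right.\<close>
        have "?u * ?g * ?v \<in> word_span ?S"
        proof -
          have "Poly_Mapping.keys (?u * ?g * ?v) \<subseteq> {u @ m @ v | m. m \<in> Poly_Mapping.keys ?g}"
            using Poly_Mapping.keys_mult[of ?u ?g] Poly_Mapping.keys_mult[of "?u * ?g" ?v]
            by (fastforce simp: plus_list_def)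
          moreover have "u @ m @ v \<in> ?S" if "m \<in> Poly_Mapping.keys ?g" for m
          proof -
            have "m \<in> Poly_Mapping.keys g" "m \<noteq> LT r g" using that keys by auto
            then have "(m, LT r g) \<in> r - Id" "m \<in> lists X"
              using LT_props[OF wo gX nz] gX by (auto simp: word_span_def)
            then show ?thesis
              using r u v unfolding admissible_order_def uv by auto
          qed
          ultimately show ?thesis unfolding word_span_def by blast
        qed
        then obtain f' where f': "f' \<in> word_span ?N" "?u * ?g * ?v - f' \<in> I"
          using normal_form_linear[of ?S ?N] less.IH by blast
        have "Poly_Mapping.single w 1 - f' = ?u * g * ?v + (?u * ?g * ?v - f')"
          by (simp add: algebra_simps single_mult_single uv)
        also have "\<dots> \<in> I"
          using f'(2) ideal_mult[OF gI] u v by (intro ideal_add) (auto intro: single_in_word_span)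
        finally show ?thesis using f'(1) by blast
      qed
    qed
  qed
  then show ?thesis using normal_form_linear[of "lists X" ?N f] f by blast
qed

end

section \<open>Graded quotients of the free algebra\<close>

text \<open>Both \<open>c\<close> and the family with \<open>a\<close> in degree \<open>n\<close>
  and zero elsewhere decompose \<open>a\<close>. An arbitrary finite \<open>J\<close> containing the
  support spares later arguments from computing the exact support.\<close>

lemma graded_component_unique:
  assumes "ring A" and graded: "graded_algebra A K V" and a: "a \<in> V n"
    and J: "finite J" and c: "\<And>j. c j \<in> V j" "\<And>j. j \<notin> J \<Longrightarrow> c j = \<zero>\<^bsub>A\<^esub>"
    and sum: "a = finsum A c J"
  shows "c n = a"
proof -
  interpret ring A by fact
  have V: "subalgebra K (V j) A" for j using graded by (simp add: graded_algebra_def)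
  have V_carrier: "V j \<subseteq> carrier A" and V_zero: "\<zero>\<^bsub>A\<^esub> \<in> V j" for j
    using subalgebra_in_carrier[OF V] subgroup.one_closed[OF subalgebra.axioms(1)[OF V[of j]]] by auto
  define P where "P e \<longleftrightarrow> (\<forall>j. e j \<in> V j) \<and> finite {j. e j \<noteq> \<zero>\<^bsub>A\<^esub>} \<and>
    a = finsum A e {j. e j \<noteq> \<zero>\<^bsub>A\<^esub>}" for e
  have P: "P e"
    if "finite J" "\<And>j. e j \<in> V j" "\<And>j. j \<notin> J \<Longrightarrow> e j = \<zero>\<^bsub>A\<^esub>" "a = finsum A e J" for e J
    unfolding P_def
  proof (intro conjI allI)
    have sub: "{j. e j \<noteq> \<zero>\<^bsub>A\<^esub>} \<subseteq> J" using that(3) by blast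
    then show "finite {j. e j \<noteq> \<zero>\<^bsub>A\<^esub>}" using that(1) by (rule finite_subset)
    have "finsum A e {j. e j \<noteq> \<zero>\<^bsub>A\<^esub>} = finsum A e J"
      by (rule add.finprod_mono_neutral_cong_left)
        (use that(1,3) sub subsetD[OF V_carrier that(2)] in auto)
    with that(4) show "a = finsum A e {j. e j \<noteq> \<zero>\<^bsub>A\<^esub>}" by simp
  qed (fact that(2))
  have aA: "a \<in> carrier A" using a V_carrier by blast
  then have "\<exists>!c. P c"
    using graded unfolding graded_algebra_def P_def by blast
  moreover have "P (\<lambda>j. if j = n then a else \<zero>\<^bsub>A\<^esub>)"
    by (rule P[of "{n}"]) (use a aA V_zero in auto)
  moreover have "P c" by (rule P[OF J c sum])
  ultimately have "c = (\<lambda>j. if j = n then a else \<zero>\<^bsub>A\<^esub>)" by blast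
  then show ?thesis by simp
qed

text \<open>This is not part of the definition of a grading. If 1 is the sum of the c_j, comparing
  components in \<open>a\<close> = sum of a c_j gives a c_0 = a for homogeneous \<open>a\<close>;
  applied to every c_j and summed, this yields c_0 = 1.\<close>

lemma graded_one:
  assumes "ring A" and graded: "graded_algebra A K V"
  shows "\<one>\<^bsub>A\<^esub> \<in> V 0"
proof -
  interpret ring A by fact
  have V: "subalgebra K (V j) A" for j using graded by (simp add: graded_algebra_def)
  have V_carrier: "V j \<subseteq> carrier A" and V_zero: "\<zero>\<^bsub>A\<^esub> \<in> V j" for j
    using subalgebra_in_carrier[OF V] subgroup.one_closed[OF subalgebra.axioms(1)[OF V[of j]]] by auto
  have V_mult: "a \<otimes>\<^bsub>A\<^esub> b \<in> V (i + j)" if "a \<in> V i" "b \<in> V j" for a b i j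
    using graded that by (auto simp: graded_algebra_def)
  obtain c where c: "\<And>j. c j \<in> V j" "finite {j. c j \<noteq> \<zero>\<^bsub>A\<^esub>}"
    "\<one>\<^bsub>A\<^esub> = finsum A c {j. c j \<noteq> \<zero>\<^bsub>A\<^esub>}"
    using graded unfolding graded_algebra_def by (metis one_closed)
  let ?J = "{j. c j \<noteq> \<zero>\<^bsub>A\<^esub>}"
  have cA: "c j \<in> carrier A" for j using c(1) V_carrier by blast
  have right: "a \<otimes>\<^bsub>A\<^esub> c 0 = a" if a: "a \<in> V n" for a n
  proof -
    \<comment> \<open>Multiplication by \<open>a\<close> shifts degrees by \<open>n\<close>; the
      case distinction guards against truncated subtraction.\<close>
    let ?e = "\<lambda>k. if k < n then \<zero>\<^bsub>A\<^esub> else a \<otimes>\<^bsub>A\<^esub> c (k - n)"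
    have aA: "a \<in> carrier A" using a V_carrier by blast
    have "?e n = a"
    proof (rule graded_component_unique[OF \<open>ring A\<close> graded a, where c = ?e])
      show "finite ((+) n ` ?J)" using c(2) by simp
      show "?e k \<in> V k" for k
        using V_mult[OF a c(1), of "k - n"] V_zero by auto
      show "?e k = \<zero>\<^bsub>A\<^esub>" if "k \<notin> (+) n ` ?J" for k
      proof (cases "k < n")
        case False
        then have "k = n + (k - n)" by simp
        with that have "k - n \<notin> ?J" by blast
        with aA show ?thesis by simp
      qed simp
      have "finsum A ?e ((+) n ` ?J) = finsum A (\<lambda>j. ?e (n + j)) ?J"
        by (rule finsum_reindex) (use aA cA in auto)
      also have "\<dots> = finsum A (\<lambda>j. a \<otimes>\<^bsub>A\<^esub> c j) ?J"
        by simp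
      also have "\<dots> = a \<otimes>\<^bsub>A\<^esub> finsum A c ?J"
        by (rule finsum_rdistr[symmetric]) (use c(2) aA cA in auto)
      also have "\<dots> = a" using aA by (simp flip: c(3))
      finally show "a = finsum A ?e ((+) n ` ?J)" by (rule sym)
    qed
    then show ?thesis by simp
  qed
  have "c 0 = \<one>\<^bsub>A\<^esub> \<otimes>\<^bsub>A\<^esub> c 0" using cA by simp
  also have "\<dots> = finsum A c ?J \<otimes>\<^bsub>A\<^esub> c 0" using c(3) by simp
  also have "\<dots> = finsum A (\<lambda>j. c j \<otimes>\<^bsub>A\<^esub> c 0) ?J"
    by (rule finsum_ldistr) (use c(2) cA in auto)
  also have "\<dots> = \<one>\<^bsub>A\<^esub>" using right[OF c(1)] c(3) by simp
  finally show ?thesis using c(1)[of 0] by simp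
qed

section \<open>Identification of the graded components\<close>

context free_algebra_hom
begin

lemma word_in_component:
  assumes graded: "graded_algebra A scalars V"
    and gens: "\<And>x. x \<in> X \<Longrightarrow> h (Poly_Mapping.single [x] 1) \<in> V (d x)"
    and "w \<in> lists X"
  shows "h (Poly_Mapping.single w 1) \<in> V (word_degree d w)"
  using assms(3)
proof (induction w)
  case Nil
  then show ?case
    using graded_one[OF S.ring_axioms graded] hom_one by (simp add: one_eq_single)
next
  case (Cons x w)
  have "h (Poly_Mapping.single (x # w) 1) =
      h (Poly_Mapping.single [x] 1) \<otimes> h (Poly_Mapping.single w 1)"
    using hom_mult[of "Poly_Mapping.single [x] 1" "Poly_Mapping.single w 1"] Cons
    by (simp add: single_carrier single_mult_single)
  then show ?case
    using Cons gens graded by (simp add: graded_algebra_def)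
qed

lemma word_span_in_component:
  assumes graded: "graded_algebra A scalars V"
    and gens: "\<And>x. x \<in> X \<Longrightarrow> h (Poly_Mapping.single [x] 1) \<in> V (d x)"
    and f: "f \<in> word_span {w \<in> lists X. word_degree d w = n}"
  shows "h f \<in> V n"
  using f
proof (induction rule: word_span_induct)
  have V: "subalgebra scalars (V n) A" using graded by (simp add: graded_algebra_def)
  {
    case zero
    then show ?case
      using subgroup.one_closed[OF subalgebra.axioms(1)[OF V]] hom_zero by simp
  next
    case (add w c f)
    have w: "w \<in> lists X" using add.hyps by simp
    have "f \<in> word_span (lists X)" using add.hyps by (auto simp: word_span_def)
    then have "h (Poly_Mapping.single w c + f) =
        h (Poly_Mapping.single [] c) \<otimes> h (Poly_Mapping.single w 1) \<oplus> h f"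
      unfolding hom_single[OF w, of c, symmetric]
      by (intro hom_add_free) (use w in \<open>auto intro: single_in_word_span\<close>)
    moreover have "h (Poly_Mapping.single [] c) \<otimes> h (Poly_Mapping.single w 1) \<in> V n"
      using word_in_component[OF graded gens, of w] add.hyps
      by (intro subalgebra.smult_closed[OF V]) (auto simp: base_field_def)
    ultimately show ?case
      using subgroup.m_closed[OF subalgebra.axioms(1)[OF V]] add.IH by simp
  }
qed

text \<open>Grouping terms by degree does not leave the span of \<open>N\<close>, so for normal
  words the homogeneous parts are again combinations of normal words.\<close>

lemma homogeneous_decomposition:
  assumes "N \<subseteq> lists X" "f \<in> word_span N"
  shows "\<exists>c J. finite J \<and> (\<forall>j. c j \<in> h ` word_span {w \<in> N. word_degree d w = j}) \<and>
    (\<forall>j. j \<notin> J \<longrightarrow> c j = \<zero>) \<and> h f = finsum A c J"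
  using assms(2)
proof (induction rule: word_span_induct)
  case zero
  have "\<zero> \<in> h ` word_span {w \<in> N. word_degree d w = j}" for j
    using hom_zero by (intro image_eqI[of _ _ 0]) auto
  then show ?case using hom_zero by (intro exI[of _ "\<lambda>_. \<zero>"] exI[of _ "{}"]) auto
next
  case (add w k f)
  then obtain c J where J: "finite J" and c: "\<And>j. c j \<in> h ` word_span {w \<in> N. word_degree d w = j}"
    "\<And>j. j \<notin> J \<Longrightarrow> c j = \<zero>" "h f = finsum A c J"
    by blast
  let ?n = "word_degree d w" and ?w = "Poly_Mapping.single w k"
  \<comment> \<open>A new term affects only the component of its own degree; \<open>?n\<close> joins
    \<open>J\<close> in case that component was zero before.\<close>
  let ?e = "c(?n := h ?w \<oplus> c ?n)"
  have sub: "word_span {w \<in> N. word_degree d w = j} \<subseteq> word_span (lists X)" for j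
    using assms(1) by (intro word_span_mono) auto
  have w: "?w \<in> word_span (lists X)" "?w \<in> word_span {w' \<in> N. word_degree d w' = ?n}"
    using add.hyps assms(1) by (auto intro: single_in_word_span)
  have f: "f \<in> word_span (lists X)" using add.hyps word_span_mono[OF assms(1)] by blast
  have cA: "c j \<in> carrier A" for j
    using c(1)[of j] sub[of j] by (auto simp flip: carrier_free_algebra)
  have wA: "h ?w \<in> carrier A" using w by (simp flip: carrier_free_algebra)
  have e: "?e j \<in> h ` word_span {w \<in> N. word_degree d w = j}" for j
  proof (cases "j = ?n")
    case True
    obtain g where g: "g \<in> word_span {w' \<in> N. word_degree d w' = ?n}" "c ?n = h g"
      using c(1)[of ?n] by auto
    have "h ?w \<oplus> c ?n = h (?w + g)"
      using g w sub[of ?n] by (subst hom_add_free) auto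
    with True add_in_word_span[OF w(2) g(1)] show ?thesis by auto
  qed (use c(1) in auto)
  have "h (?w + f) = h ?w \<oplus> finsum A c J"
    using w f c(3) by (simp add: hom_add_free)
  also have "finsum A c J = finsum A c (insert ?n J)"
    by (rule S.add.finprod_mono_neutral_cong_left) (use J c cA in auto)
  also have "\<dots> = c ?n \<oplus> finsum A c (J - {?n})"
    using S.finsum_insert[of "J - {?n}" ?n c] J cA by simp
  also have "h ?w \<oplus> (c ?n \<oplus> finsum A c (J - {?n})) = ?e ?n \<oplus> finsum A c (J - {?n})"
    using wA cA by (simp add: S.a_assoc S.finsum_closed)
  also have "finsum A c (J - {?n}) = finsum A ?e (J - {?n})"
    by (rule S.finsum_cong') (use cA in auto)
  also have "?e ?n \<oplus> \<dots> = finsum A ?e (insert ?n J)"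
    using S.finsum_insert[of "J - {?n}" ?n ?e] J cA wA by simp
  finally have sum: "h (?w + f) = finsum A ?e (insert ?n J)" .
  show ?case
  proof (rule exI[of _ ?e], rule exI[of _ "insert ?n J"], intro conjI allI)
    show "?e j \<in> h ` word_span {w \<in> N. word_degree d w = j}" for j by (fact e)
    show "j \<notin> insert ?n J \<longrightarrow> ?e j = \<zero>" for j using c(2) by simp
  qed (use J in simp, fact sum)
qed

text \<open>For the inclusion from left to right, write \<open>a\<close> as the image of a
  combination of words in \<open>N\<close> and group by degree. Each group lies in its component, so
  by uniqueness the group of degree \<open>n\<close> already has image \<open>a\<close>.\<close>

lemma component_eq_word_span:
  assumes graded: "graded_algebra A scalars V"
    and gens: "\<And>x. x \<in> X \<Longrightarrow> h (Poly_Mapping.single [x] 1) \<in> V (d x)"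
    and N: "N \<subseteq> lists X" and spanning: "carrier A \<subseteq> h ` word_span N"
  shows "V n = h ` word_span {w \<in> N. word_degree d w = n}"
proof (intro equalityI subsetI)
  fix a assume "a \<in> h ` word_span {w \<in> N. word_degree d w = n}"
  then obtain f where f: "a = h f" "f \<in> word_span {w \<in> N. word_degree d w = n}" by auto
  have "f \<in> word_span {w \<in> lists X. word_degree d w = n}"
    using f(2) N by (auto simp: word_span_def)
  then show "a \<in> V n"
    unfolding f(1) by (rule word_span_in_component[OF graded, where d = d, rotated]) (rule gens)
next
  fix a assume a: "a \<in> V n"
  have "subalgebra scalars (V n) A" using graded by (simp add: graded_algebra_def)
  then have "a \<in> carrier A" using S.subalgebra_in_carrier a by blast
  then obtain f where f: "f \<in> word_span N" "a = h f" using spanning by auto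
  obtain c J where J: "finite J" and c: "\<And>j. c j \<in> h ` word_span {w \<in> N. word_degree d w = j}"
    "\<And>j. j \<notin> J \<Longrightarrow> c j = \<zero>" "h f = finsum A c J"
    using homogeneous_decomposition[OF N f(1), of d] by blast
  have "c j \<in> V j" for j
  proof -
    obtain g where g: "c j = h g" "g \<in> word_span {w \<in> N. word_degree d w = j}" using c(1) by blast
    then have "g \<in> word_span {w \<in> lists X. word_degree d w = j}"
      using N by (auto simp: word_span_def)
    then show ?thesis
      unfolding g(1) by (rule word_span_in_component[OF graded, where d = d, rotated]) (rule gens)
  qed
  then have "c n = a"
    using graded_component_unique[OF S.ring_axioms graded a J] c(2,3) f(2) by simp
  then show "a \<in> h ` word_span {w \<in> N. word_degree d w = n}" using c(1)[of n] by simp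
qed

end

section \<open>The Hilbert series of the presented algebra\<close>

theorem theorem7p4p2:
  fixes X :: "'x set"
    and d :: "'x \<Rightarrow> nat"
    and R G :: "('x list \<Rightarrow>\<^sub>0 'k::field) set"
    and r :: "'x list rel"
    and A :: "(('x list \<Rightarrow>\<^sub>0 'k) set) ring"
    and V :: "nat \<Rightarrow> ('x list \<Rightarrow>\<^sub>0 'k) set set"
    and F :: "'x list set"
    and C :: "int \<Rightarrow> ('x list \<Rightarrow>\<^sub>0 'k) set"
    and H :: "('x list \<Rightarrow>\<^sub>0 'k) set \<Rightarrow> rat fps"
    and H_A :: "rat fps"
  assumes relations: "R \<subseteq> carrier (free_algebra X)"
    and A: "A = presented_algebra X R"
    and nonzero: "\<one>\<^bsub>A\<^esub> \<noteq> \<zero>\<^bsub>A\<^esub>"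
    and degree_pos: "\<And>x. x \<in> X \<Longrightarrow> d x > 0"
    and degree_finite: "\<And>n. finite {x \<in> X. d x = n}"
    and graded: "graded_algebra A (residue_class X R ` base_field) V"
    and generators: "\<And>x. x \<in> X \<Longrightarrow> residue_class X R (Poly_Mapping.single [x] 1) \<in> V (d x)"
    and order: "admissible_order X r"
    and groebner: "reduced_groebner_basis X r (Idl\<^bsub>free_algebra X\<^esub> R) G"
    and F: "F = LT r ` G"
    and C: "\<And>n. C n = chain_space X F n"
    and H: "\<And>W. H W = hilbert_series_subspace X d W"
    and H_A: "H_A = hilbert_series A (residue_class X R ` base_field) V"
  shows "H (C (- 1)) = H base_field \<and> H base_field = 1 \<and>
    H (C 0) = H (word_span {[x] | x. x \<in> X}) \<and>
    H (C 1) = H (word_span F) \<and>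
    summable (\<lambda>n. (- 1) ^ n * H (C (int n - 1))) \<and>
    H_A = inverse (suminf (\<lambda>n. (- 1) ^ n * H (C (int n - 1))))"
proof -
  let ?K = "free_algebra X :: ('x list \<Rightarrow>\<^sub>0 'k) ring"
  let ?I = "Idl\<^bsub>?K\<^esub> R" and ?\<phi> = "residue_class X R" and ?N = "normal_words X F"
  interpret free_ring: ring ?K by (rule ring_free_algebra)
  interpret free_algebra_ideal X ?I
    by (intro free_algebra_ideal.intro free_ring.genideal_ideal relations)
  have \<phi>: "?\<phi> = (+>\<^bsub>?K\<^esub>) ?I" by (rule ext) (simp add: residue_class_def)
  have AI: "A = ?K Quot ?I" by (simp add: A presented_algebra_def)
  interpret quotient: free_algebra_hom X A ?\<phi>
    unfolding \<phi> using nonzero unfolding AI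
    by (intro free_algebra_hom.intro rcos_ring_hom_ring free_algebra_hom_axioms.intro)
  have zeroA: "\<zero>\<^bsub>A\<^esub> = ?I" by (simp add: AI FactRing_def)
  have kernel: "?\<phi> f = \<zero>\<^bsub>A\<^esub> \<longleftrightarrow> f \<in> ?I" if "f \<in> word_span (lists X)" for f
    using rcos_const_imp_mem[of f] a_rcos_const[of f] that
    unfolding \<phi> zeroA carrier_free_algebra by blast
  have wo: "well_order_on (lists X) r" using order by (simp add: admissible_order_def)
  have G: "groebner_basis r ?I G" and monic: "\<And>g. g \<in> G \<Longrightarrow> LC r g = 1"
    and minimal: "\<And>g. g \<in> G \<Longrightarrow> LT r g \<in> normal_words X (LT r ` (G - {g}))"
    using groebner by (auto simp: reduced_groebner_basis_def)
  have N_lists: "?N \<subseteq> lists X" by (auto simp: normal_words_def)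
  have spanning: "carrier A \<subseteq> ?\<phi> ` word_span ?N"
  proof
    fix a assume "a \<in> carrier A"
    then obtain f where f: "f \<in> word_span (lists X)" "a = ?\<phi> f"
      by (auto simp: AI FactRing_def A_RCOSETS_def' \<phi> carrier_free_algebra)
    obtain f' where f': "f' \<in> word_span ?N" "f - f' \<in> ?I"
      using normal_form_exists[OF order G monic f(1)] unfolding F by blast
    have f'X: "f' \<in> word_span (lists X)" using f'(1) word_span_mono[OF N_lists] by blast
    have "?\<phi> f = ?\<phi> f'"
      using quotient.hom_eq_iff[OF f(1) f'X] kernel[OF diff_in_word_span[OF f(1) f'X]] f'(2) by simp
    with f(2) f'(1) show "a \<in> ?\<phi> ` word_span ?N" by blast
  qed
  \<comment> \<open>An empty obstruction would leave no normal words at all, and since these span,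
    the algebra would be zero.\<close>
  have Nil: "[] \<notin> F"
  proof
    assume "[] \<in> F"
    then have "?N = {}" by (auto simp: normal_words_def)
    then have "carrier A \<subseteq> {?\<phi> 0}" using spanning by (auto simp: word_span_def)
    then show False
      using quotient.S.one_closed quotient.S.zero_closed nonzero by (metis singletonD subsetD)
  qed
  interpret graded_obstructions X F d
  proof
    show "F \<subseteq> lists X" unfolding F using minimal by (auto simp: normal_words_def)
    \<comment> \<open>The antichain condition comes from minimality of the reduced basis: distinct
      leading terms belong to distinct basis elements, and \<open>LT r g'\<close> is normal for the
      others.\<close>
    show "f = f'" if "f \<in> F" "f' \<in> F" "sublist f f'" for f f'
    proof (rule ccontr)
      assume "f \<noteq> f'"
      with that obtain g g' where "g \<in> G" "g' \<in> G" "f = LT r g" "f' = LT r g'" "g \<noteq> g'"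
        unfolding F by blast
      with minimal[of g'] that(3) show False by (auto simp: normal_words_def)
    qed
  qed (fact Nil degree_pos degree_finite)+
  have H_span: "H (word_span T) = weight_series wdeg T" if "T \<subseteq> lists X" for T
    unfolding H using degree_pos degree_finite that by (rule hilbert_series_subspace_word_span)
  have H_C: "H (C n) = weight_series wdeg {w. \<exists>t. chain X F n w t}" for n
    unfolding C chain_space_def by (rule H_span) (use chain_props in blast)
  have chain_minus_one: "{w. \<exists>t. chain X F (- 1) w t} = {[]}"
    by (auto intro: chain.empty elim: chain.cases)
  have chain_zero: "{w. \<exists>t. chain X F 0 w t} = {[x] | x. x \<in> X}"
    by (auto intro: chain.letter elim: chain.cases)
  have H_base: "H base_field = 1"
    unfolding base_field_eq_word_span by (subst H_span) (simp_all add: weight_series_Nil)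
  have H_A_normals: "H_A = weight_series wdeg ?N"
  proof (rule fps_ext)
    fix n
    have "V = (\<lambda>n. ?\<phi> ` word_span {w \<in> ?N. wdeg w = n})"
      using quotient.component_eq_word_span[OF graded _ N_lists spanning] generators by blast
    \<comment> \<open>Residues of normal words are independent in each degree, so the dimension of
      \<open>V n\<close> is the number of normal words of degree \<open>n\<close>.\<close>
    moreover have "f = 0" if "f \<in> word_span {w \<in> ?N. wdeg w = m}" "?\<phi> f = \<zero>\<^bsub>A\<^esub>" for m f
    proof (rule normal_word_span_Int_ideal[OF wo G])
      show "f \<in> word_span (normal_words X (LT r ` G))"
        using that(1) by (auto simp: word_span_def F)
      then have "f \<in> word_span (lists X)"
        using word_span_mono[OF N_lists] unfolding F by blast
      then show "f \<in> ?I" using kernel that(2) by blast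
    qed
    ultimately show "H_A $ n = weight_series wdeg ?N $ n"
      unfolding H_A weight_series_nth
      by (simp only:) (rule quotient.hilbert_series_word_span,
        use finite_words[OF N_lists] N_lists in auto)
  qed
  show ?thesis
  proof (intro conjI)
    show "H (C (- 1)) = H base_field"
      unfolding H_C chain_minus_one H_base by (rule weight_series_Nil)
    show "H (C 0) = H (word_span {[x] | x. x \<in> X})"
      unfolding H_C chain_zero by (rule H_span[symmetric]) auto
    show "H (C 1) = H (word_span F)"
      unfolding H_C chain_one_iff by (simp add: H_span[OF obstruction_words])
    show "summable (\<lambda>n. (- 1) ^ n * H (C (int n - 1)))"
      unfolding H_C by (rule chains_normals_inverse(1))
    show "H_A = inverse (suminf (\<lambda>n. (- 1) ^ n * H (C (int n - 1))))"
      unfolding H_C H_A_normals by (rule chains_normals_inverse(2))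
  qed (fact H_base)
qed

end
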